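(* Let $(V,\lhd,\rhd,\circ)$ be a simple pre-Gel'fand-Dorfman algebra over $\mathbb{C}$ with $\rhd$ trivial (i.e. $a\rhd b=0$ for all $a,b\in V$). If there exists an element $a\in V$ such that for all non-zero $b\in V$ one has $a\lhd b\neq 0$ or $b\lhd a\neq 0$, then the quadratic left-symmetric conformal algebra $R=\mathbb{C}[\partial]V$ corresponding to $(V,\lhd,\rhd,\circ)$ is simple.
   Context: All vector spaces are over $\mathbb{C}$. A left-symmetric algebra $(A,\circ)$ is a vector space with a bilinear product satisfying $(a\circ b)\circ c-a\circ(b\circ c)=(b\circ a)\circ c-b\circ(a\circ c)$. A left-symmetric conformal algebra is a $\mathbb{C}[\partial]$-module $R$ with a $\mathbb{C}$-bilinear map $R\times R\to R[\lambda]$, $(a,b)\mapsto a_\lambda b$, such that $\partial a_\lambda b=-\lambda a_\lambda b$, $a_\lambda\partial b=(\partial+\lambda)a_\lambda b$ (conformal sesquilinearity), and $(a_\lambda b)_{\lambda+\mu}c-a_\lambda(b_\mu c)=(b_\mu a)_{\lambda+\mu}c-b_\mu(a_\lambda c)$. An ideal of $R$ is a $\mathbb{C}[\partial]$-submodule $I$ with $I_\lambda R\subseteq I[\lambda]$ and $R_\lambda I\subseteq I[\lambda]$; it is proper if $I\neq 0,R$. $R$ is simple if it is non-trivial (its $\lambda$-product is not identically zero) and has no proper ideals. A pre-Novikov algebra $(A,\lhd,\rhd)$ is a vector space with two bilinear operations such that for all $a,b,c\in A$: $a\rhd(b\rhd c)=(a\rhd b+a\lhd b)\rhd c+b\rhd(a\rhd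 c)-(b\rhd a+b\lhd a)\rhd c$; $a\rhd(b\lhd c)=(a\rhd b)\lhd c+b\lhd(a\lhd c+a\rhd c)-(b\lhd a)\lhd c$; $(a\lhd b+a\rhd b)\rhd c=(a\rhd c)\lhd b$; $(a\lhd b)\lhd c=(a\lhd c)\lhd b$. A pre-Gel'fand-Dorfman algebra $(A,\lhd,\rhd,\circ)$ is a vector space such that $(A,\lhd,\rhd)$ is a pre-Novikov algebra, $(A,\circ)$ is a left-symmetric algebra, and for all $a,b,c$: $c\lhd(a\circ b-b\circ a)-a\circ(c\lhd b)-(b\circ c)\lhd a=-b\circ(c\lhd a)-(a\circ c)\lhd b$; $(a\circ b-b\circ a)\rhd c+(a\lhd b+a\rhd b)\circ c=a\rhd(b\circ c)-b\circ(a\rhd c)+(a\circ c)\lhd b$. A proper ideal of $(V,\lhd,\rhd,\circ)$ is a subspace $I\neq 0,V$ with $a\lhd b,\,b\lhd a,\,a\rhd b,\,b\rhd a,\,a\circ b,\,b\circ a\in I$ for all $a\in I$, $b\in V$. $(V,\lhd,\rhd,\circ)$ is simple if it is non-trivial (its operations are not all identically zero) and has no proper ideals. The quadratic left-symmetric conformal algebra corresponding to $(V,\lhd,\rhd,\circ)$ is the free $\mathbb{C}[\partial]$-module $R=\mathbb{C}[\partial]V=\mathbb{C}[\partial]\otimes V$ with $a_\lambda b=\partial(b\lhd a)+a\circ b+\lambda(a\rhd b+b\lhd a)$ for $a,b\in V$, extended by conformal sesquilinearity (this is a left-symmetric conformal algebra). *)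

theory Defs
  imports Complex_Main "HOL-Computational_Algebra.Polynomial"
begin

text \<open>A vector space over the complex numbers is given by a type together with a scalar
  multiplication satisfying \<^locale>\<open>vector_space\<close>; likewise a module over the polynomial ring
  in \<open>\<partial>\<close> satisfies \<^locale>\<open>module\<close> with scalars in \<^typ>\<open>complex poly\<close>, where \<open>\<partial>\<close> is
  \<open>[:0, 1:]\<close>.\<close>

definition module_bilinear ::
  "('c::comm_ring_1 \<Rightarrow> 'x::ab_group_add \<Rightarrow> 'x) \<Rightarrow> ('c \<Rightarrow> 'y::ab_group_add \<Rightarrow> 'y) \<Rightarrow>
   ('c \<Rightarrow> 'z::ab_group_add \<Rightarrow> 'z) \<Rightarrow> ('x \<Rightarrow> 'y \<Rightarrow> 'z) \<Rightarrow> bool"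
  where "module_bilinear s t u f \<longleftrightarrow>
    (\<forall>y. module_hom s u (\<lambda>x. f x y)) \<and> (\<forall>x. module_hom t u (f x))"


section \<open>Pre-Gel'fand-Dorfman algebras\<close>

locale left_symmetric_algebra = vector_space scale
  for scale :: "complex \<Rightarrow> 'a::ab_group_add \<Rightarrow> 'a" +
  fixes lsa :: "'a \<Rightarrow> 'a \<Rightarrow> 'a" (infixl \<open>\<odot>\<close> 70)
  assumes bilinear_lsa: "module_bilinear scale scale scale (\<odot>)"
    and left_symmetric:
      "(a \<odot> b) \<odot> c - a \<odot> (b \<odot> c) = (b \<odot> a) \<odot> c - b \<odot> (a \<odot> c)"

locale pre_novikov_algebra = vector_space scale
  for scale :: "complex \<Rightarrow> 'a::ab_group_add \<Rightarrow> 'a" +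
  fixes lhd :: "'a \<Rightarrow> 'a \<Rightarrow> 'a" (infixl \<open>\<lhd>\<close> 70)
    and rhd :: "'a \<Rightarrow> 'a \<Rightarrow> 'a" (infixl \<open>\<rhd>\<close> 70)
  assumes bilinear_lhd: "module_bilinear scale scale scale (\<lhd>)"
    and bilinear_rhd: "module_bilinear scale scale scale (\<rhd>)"
    and pre_novikov_1:
      "a \<rhd> (b \<rhd> c) = (a \<rhd> b + a \<lhd> b) \<rhd> c + b \<rhd> (a \<rhd> c) - (b \<rhd> a + b \<lhd> a) \<rhd> c"
    and pre_novikov_2:
      "a \<rhd> (b \<lhd> c) = (a \<rhd> b) \<lhd> c + b \<lhd> (a \<lhd> c + a \<rhd> c) - (b \<lhd> a) \<lhd> c"
    and pre_novikov_3: "(a \<lhd> b + a \<rhd> b) \<rhd> c = (a \<rhd> c) \<lhd> b"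
    and pre_novikov_4: "(a \<lhd> b) \<lhd> c = (a \<lhd> c) \<lhd> b"

locale pre_gelfand_dorfman_algebra =
  pre_novikov_algebra scale lhd rhd + left_symmetric_algebra scale lsa
  for scale :: "complex \<Rightarrow> 'a::ab_group_add \<Rightarrow> 'a"
    and lhd :: "'a \<Rightarrow> 'a \<Rightarrow> 'a" (infixl \<open>\<lhd>\<close> 70)
    and rhd :: "'a \<Rightarrow> 'a \<Rightarrow> 'a" (infixl \<open>\<rhd>\<close> 70)
    and lsa :: "'a \<Rightarrow> 'a \<Rightarrow> 'a" (infixl \<open>\<odot>\<close> 70) +
  assumes pre_gelfand_dorfman_1:
      "c \<lhd> (a \<odot> b - b \<odot> a) - a \<odot> (c \<lhd> b) - (b \<odot> c) \<lhd> a = - (b \<odot> (c \<lhd> a)) - (a \<odot> c) \<lhd> b"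
    and pre_gelfand_dorfman_2:
      "(a \<odot> b - b \<odot> a) \<rhd> c + (a \<lhd> b + a \<rhd> b) \<odot> c = a \<rhd> (b \<odot> c) - b \<odot> (a \<rhd> c) + (a \<odot> c) \<lhd> b"
begin

definition proper_ideal :: "'a set \<Rightarrow> bool"
  where "proper_ideal I \<longleftrightarrow> subspace I \<and> I \<noteq> {0} \<and> I \<noteq> UNIV \<and>
    (\<forall>a\<in>I. \<forall>b. a \<lhd> b \<in> I \<and> b \<lhd> a \<in> I \<and> a \<rhd> b \<in> I \<and> b \<rhd> a \<in> I \<and> a \<odot> b \<in> I \<and> b \<odot> a \<in> I)"

end

locale simple_pre_gelfand_dorfman_algebra = pre_gelfand_dorfman_algebra +
  assumes nontrivial: "\<not> (\<forall>a b. lhd a b = 0 \<and> rhd a b = 0 \<and> lsa a b = 0)"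
    and no_proper_ideal: "\<not> (\<exists>I. proper_ideal I)"


section \<open>Left-symmetric conformal algebras\<close>

text \<open>\<open>R[\<lambda>]\<close> is \<^typ>\<open>'r poly\<close>, and \<open>R[\<lambda>,\<mu>]\<close> is \<^typ>\<open>'r poly poly\<close>, with \<open>\<lambda>\<close> the outer and
  \<open>\<mu>\<close> the inner variable.\<close>

abbreviation (input) mult_outer :: "'r::comm_monoid_add poly \<Rightarrow> 'r poly"
  where "mult_outer \<equiv> pCons 0"

abbreviation (input) mult_inner :: "'r::comm_monoid_add poly poly \<Rightarrow> 'r poly poly"
  where "mult_inner \<equiv> map_poly (pCons 0)"

abbreviation (input) mult_outer_inner :: "'r::comm_monoid_add poly poly \<Rightarrow> 'r poly poly"
  where "mult_outer_inner q \<equiv> mult_outer q + mult_inner q"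

text \<open>In the next three definitions \<open>X\<close> and \<open>Y\<close> are additive operators on \<open>R[\<lambda>,\<mu>]\<close>, namely the
  multiplications by \<open>\<lambda>\<close>, by \<open>\<mu>\<close> or by \<open>\<lambda> + \<mu>\<close>. Substituting \<open>X\<close> for the variable of
  \<open>\<Sum>\<^sub>n r\<^sub>n \<nu>\<^sup>n\<close> gives \<open>\<Sum>\<^sub>n X\<^sup>n r\<^sub>n\<close>.\<close>

definition subst_op ::
  "('r::comm_monoid_add poly poly \<Rightarrow> 'r poly poly) \<Rightarrow> 'r poly \<Rightarrow> 'r poly poly"
  where "subst_op X p = (\<Sum>n\<le>degree p. (X ^^ n) [:[:coeff p n:]:])"

text \<open>\<open>P(X)\<^sub>Y c\<close> and \<open>a\<^sub>X P(Y)\<close>, for a polynomial \<open>P\<close> with coefficients in \<open>R\<close>; the product is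
  extended to \<open>P\<close> coefficientwise, the variable of \<open>P\<close> being left outside.\<close>

definition lprod_poly_left ::
  "('r \<Rightarrow> 'r \<Rightarrow> 'r::comm_monoid_add poly) \<Rightarrow> ('r poly poly \<Rightarrow> 'r poly poly) \<Rightarrow>
   ('r poly poly \<Rightarrow> 'r poly poly) \<Rightarrow> 'r poly \<Rightarrow> 'r \<Rightarrow> 'r poly poly"
  where "lprod_poly_left lprod X Y P c =
    (\<Sum>i\<le>degree P. (X ^^ i) (subst_op Y (lprod (coeff P i) c)))"

definition lprod_poly_right ::
  "('r \<Rightarrow> 'r \<Rightarrow> 'r::comm_monoid_add poly) \<Rightarrow> ('r poly poly \<Rightarrow> 'r poly poly) \<Rightarrow>
   ('r poly poly \<Rightarrow> 'r poly poly) \<Rightarrow> 'r \<Rightarrow> 'r poly \<Rightarrow> 'r poly poly"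
  where "lprod_poly_right lprod X Y a P =
    (\<Sum>j\<le>degree P. (Y ^^ j) (subst_op X (lprod a (coeff P j))))"

text \<open>\<open>lprod a b\<close> is \<open>a\<^sub>\<lambda> b\<close>, an element of \<open>R[\<lambda>]\<close>. The assumption \<open>conformal_left_symmetric\<close> is
  \<open>(a\<^sub>\<lambda> b)\<^bsub>\<lambda>+\<mu>\<^esub> c - a\<^sub>\<lambda> (b\<^sub>\<mu> c) = (b\<^sub>\<mu> a)\<^bsub>\<lambda>+\<mu>\<^esub> c - b\<^sub>\<mu> (a\<^sub>\<lambda> c)\<close>.\<close>

locale left_symmetric_conformal_algebra = module scale
  for scale :: "complex poly \<Rightarrow> 'r::ab_group_add \<Rightarrow> 'r" +
  fixes lprod :: "'r \<Rightarrow> 'r \<Rightarrow> 'r poly"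
  assumes bilinear_lprod:
      "module_bilinear (\<lambda>z::complex. scale [:z:]) (\<lambda>z. scale [:z:])
         (\<lambda>z. map_poly (scale [:z:])) lprod"
    and sesquilinear_left: "lprod (scale [:0, 1:] a) b = - pCons 0 (lprod a b)"
    and sesquilinear_right:
      "lprod a (scale [:0, 1:] b) = map_poly (scale [:0, 1:]) (lprod a b) + pCons 0 (lprod a b)"
    and conformal_left_symmetric:
      "lprod_poly_left lprod mult_outer mult_outer_inner (lprod a b) c
         - lprod_poly_right lprod mult_outer mult_inner a (lprod b c)
       = lprod_poly_left lprod mult_inner mult_outer_inner (lprod b a) c
         - lprod_poly_right lprod mult_inner mult_outer b (lprod a c)"
begin

definition conformal_ideal :: "'r set \<Rightarrow> bool"
  where "conformal_ideal I \<longleftrightarrow> subspace I \<and>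
    (\<forall>a\<in>I. \<forall>b n. coeff (lprod a b) n \<in> I \<and> coeff (lprod b a) n \<in> I)"

definition proper_conformal_ideal :: "'r set \<Rightarrow> bool"
  where "proper_conformal_ideal I \<longleftrightarrow> conformal_ideal I \<and> I \<noteq> {0} \<and> I \<noteq> UNIV"

end

locale simple_left_symmetric_conformal_algebra = left_symmetric_conformal_algebra +
  assumes nontrivial: "\<not> (\<forall>a b. lprod a b = 0)"
    and no_proper_conformal_ideal: "\<not> (\<exists>I. proper_conformal_ideal I)"


section \<open>The quadratic left-symmetric conformal algebra\<close>

text \<open>The free module generated by \<open>V\<close> is \<^typ>\<open>'a poly\<close>, the polynomials in \<open>\<partial>\<close> with coefficients
  in \<open>V\<close>: the element \<open>\<Sum>\<^sub>i \<partial>\<^sup>i \<otimes> v\<^sub>i\<close> is the polynomial with coefficients \<open>v\<^sub>i\<close>, and \<open>v \<in> V\<close> is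
  \<open>[:v:]\<close>.\<close>

definition free_scale ::
  "(complex \<Rightarrow> 'a::ab_group_add \<Rightarrow> 'a) \<Rightarrow> complex poly \<Rightarrow> 'a poly \<Rightarrow> 'a poly"
  where "free_scale scale p f =
    (\<Sum>i\<le>degree p. (pCons 0 ^^ i) (map_poly (scale (coeff p i)) f))"

text \<open>Elements of \<open>R[\<lambda>]\<close> with \<open>R = 'a poly\<close> have outer variable \<open>\<lambda>\<close> and inner variable \<open>\<partial>\<close>. The
  generator formula is \<open>a\<^sub>\<lambda> b = \<partial>(b \<lhd> a) + a \<circ> b + \<lambda>(a \<rhd> b + b \<lhd> a)\<close>, and sesquilinearity forces
  \<open>(\<partial>\<^sup>i a)\<^sub>\<lambda> (\<partial>\<^sup>j b) = (-\<lambda>)\<^sup>i (\<partial> + \<lambda>)\<^sup>j (a\<^sub>\<lambda> b)\<close>.\<close>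

definition quadratic_gen ::
  "('a \<Rightarrow> 'a \<Rightarrow> 'a) \<Rightarrow> ('a \<Rightarrow> 'a \<Rightarrow> 'a) \<Rightarrow> ('a \<Rightarrow> 'a \<Rightarrow> 'a) \<Rightarrow> 'a \<Rightarrow> 'a \<Rightarrow> 'a::ab_group_add poly poly"
  where "quadratic_gen lhd rhd lsa a b = [: [:lsa a b, lhd b a:], [:rhd a b + lhd b a:] :]"

definition quadratic_lprod ::
  "('a \<Rightarrow> 'a \<Rightarrow> 'a) \<Rightarrow> ('a \<Rightarrow> 'a \<Rightarrow> 'a) \<Rightarrow> ('a \<Rightarrow> 'a \<Rightarrow> 'a) \<Rightarrow>
   'a poly \<Rightarrow> 'a poly \<Rightarrow> 'a::ab_group_add poly poly"
  where "quadratic_lprod lhd rhd lsa f g =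
    (\<Sum>i\<le>degree f. \<Sum>j\<le>degree g.
      ((\<lambda>q. - mult_outer q) ^^ i) ((mult_outer_inner ^^ j)
        (quadratic_gen lhd rhd lsa (coeff f i) (coeff g j))))"

end

theory Submission
  imports Defs
begin

text \<open>Simplicity rests on the intersection of a conformal ideal \<open>I\<close> with \<open>V\<close>. Let
  \<open>f = \<Sum>\<^sub>i \<partial>\<^sup>i v\<^sub>i\<close> be a non-zero element of \<open>I\<close> with leading term \<open>\<partial>\<^sup>n v\<^sub>n\<close>, and let \<open>a\<close> be the
  distinguished element. By sesquilinearity the coefficients of \<open>\<lambda>\<^sup>n\<^sup>+\<^sup>1\<close> in \<open>f\<^sub>\<lambda> a\<close> and in
  \<open>a\<^sub>\<lambda> f\<close> are \<open>\<plusminus>(a \<lhd> v\<^sub>n)\<close> and \<open>v\<^sub>n \<lhd> a\<close>. Both lie in \<open>I \<inter> V\<close> and one of them is not zero, so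
  \<open>I \<inter> V \<noteq> 0\<close> (\<open>constant_part_nonzero\<close>). Since \<open>\<rhd>\<close> is trivial, \<open>v\<^sub>\<lambda> b = (\<partial> + \<lambda>)(b \<lhd> v) + v \<odot> b\<close>, and
  for \<open>v \<in> I \<inter> V\<close> one reads off \<open>b \<lhd> v \<in> I\<close> and then \<open>v \<odot> b \<in> I\<close>; thus \<open>I \<inter> V\<close> is an ideal of \<open>V\<close>
  (\<open>constant_part_closed\<close>). As \<open>V\<close> is simple, \<open>V \<subseteq> I\<close>, and \<open>V\<close> generates \<open>\<complex>[\<partial>]V\<close>.

  That \<open>\<complex>[\<partial>]V\<close> is a left-symmetric conformal algebra holds for every pre-Gel'fand-Dorfman algebra and
  takes most of the work. The difference \<open>J(a, b, c)\<close> of the two sides of conformal left symmetry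
  (\<open>symmetry_defect\<close>) is additive in each argument, and sesquilinearity gives \<open>J(\<partial>a, b, c) = -\<lambda> J(a,
      b, c)\<close>,
  \<open>J(a, \<partial>b, c) = -\<mu> J(a, b, c)\<close> and \<open>J(a, b, \<partial>c) = (\<partial> + \<lambda> + \<mu>) J(a, b, c)\<close>
  (\<open>symmetry_defect_d\<close>). So it suffices that \<open>J\<close> vanishes on \<open>V\<close>, where its ten coefficients in
  \<open>\<lambda>\<close>, \<open>\<mu>\<close>, \<open>\<partial>\<close> are consequences of the axioms (\<open>symmetry_defect_gen\<close>).\<close>

section \<open>Substituting an operator for the variable of a polynomial\<close>

text \<open>The value of a polynomial with coefficients \<open>\<phi> r\<close> at an operator \<open>X\<close>. Substitution into
  \<open>R[\<lambda>]\<close>, the two iterated products, the action of \<open>\<complex>[\<partial>]\<close> on the free module and the quadratic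
  \<open>\<lambda>\<close>-product are all of this form, so additivity, the recursion over \<^const>\<open>pCons\<close> and the fusion
  law below settle each of them.\<close>

definition subst_poly :: "('m::ab_group_add \<Rightarrow> 'm) \<Rightarrow> ('r::zero \<Rightarrow> 'm) \<Rightarrow> 'r poly \<Rightarrow> 'm"
  where "subst_poly X \<phi> p = (\<Sum>i\<le>degree p. (X ^^ i) (\<phi> (coeff p i)))"

lemma additive_funpow:
  fixes X :: "'m::ab_group_add \<Rightarrow> 'm"
  shows "additive X \<Longrightarrow> additive (X ^^ n)"
  by (induction n) (simp_all add: additive_def)

lemma additive_pCons: "additive (pCons (0::'r::ab_group_add))"
  by (simp add: additive_def)

lemma additive_map_poly: "additive f \<Longrightarrow> additive (map_poly f)"
  by (simp add: additive_def poly_eq_iff coeff_map_poly additive.zero[unfolded additive_def])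

lemma additive_add: "additive f \<Longrightarrow> additive g \<Longrightarrow> additive (\<lambda>x. f x + g x)"
  by (simp add: additive_def)

lemma additive_uminus: "additive f \<Longrightarrow> additive (\<lambda>x. - f x)"
  by (simp add: additive_def)

lemma additive_diff: "additive f \<Longrightarrow> additive g \<Longrightarrow> additive (\<lambda>x. f x - g x)"
  by (simp add: additive_def)

lemma subst_poly_eq_sum:
  assumes X: "additive X" and \<phi>: "\<phi> 0 = 0" and n: "degree p \<le> n"
  shows "subst_poly X \<phi> p = (\<Sum>i\<le>n. (X ^^ i) (\<phi> (coeff p i)))"
  unfolding subst_poly_def
proof (rule sum.mono_neutral_left)
  show "\<forall>i\<in>{..n} - {..degree p}. (X ^^ i) (\<phi> (coeff p i)) = 0"
    by (auto simp: coeff_eq_0 \<phi> additive.zero[OF additive_funpow[OF X]])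
qed (use n in auto)

lemma subst_poly_0 [simp]: "\<phi> 0 = 0 \<Longrightarrow> subst_poly X \<phi> 0 = 0"
  by (simp add: subst_poly_def)

lemma subst_poly_const [simp]: "subst_poly X \<phi> [:a:] = \<phi> a"
  by (simp add: subst_poly_def)

lemma subst_poly_pCons:
  assumes X: "additive X" and \<phi>: "\<phi> 0 = 0"
  shows "subst_poly X \<phi> (pCons a p) = \<phi> a + X (subst_poly X \<phi> p)"
proof -
  have "subst_poly X \<phi> (pCons a p) = (\<Sum>i\<le>Suc (degree p). (X ^^ i) (\<phi> (coeff (pCons a p) i)))"
    by (rule subst_poly_eq_sum[where X = X and \<phi> = \<phi>, OF X \<phi>]) (simp add: degree_pCons_le)
  also have "\<dots> = \<phi> a + X (subst_poly X \<phi> p)"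
    by (simp only: sum.atMost_Suc_shift subst_poly_def additive.sum[OF X] coeff_pCons_0 coeff_pCons_Suc
        funpow.simps o_apply id_apply)
  finally show ?thesis .
qed

lemma additive_subst_poly:
  fixes \<phi> :: "'r::ab_group_add \<Rightarrow> 'm::ab_group_add"
  assumes X: "additive X" and \<phi>: "additive \<phi>"
  shows "additive (subst_poly X \<phi>)"
proof
  fix p q :: "'r poly"
  have \<phi>0: "\<phi> 0 = 0" by (rule additive.zero[OF \<phi>])
  note sum = subst_poly_eq_sum[where X = X and \<phi> = \<phi>, OF X \<phi>0, of _ "max (degree p) (degree q)"]
  show "subst_poly X \<phi> (p + q) = subst_poly X \<phi> p + subst_poly X \<phi> q"
    by (simp add: sum degree_add_le_max additive.add[OF \<phi>]
        additive.add[OF additive_funpow[OF X]] sum.distrib)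
qed

lemma additive_subst_poly_fun:
  assumes X: "additive X" and \<phi>: "\<And>r. additive (\<lambda>x. \<phi> x r)"
  shows "additive (\<lambda>x. subst_poly X (\<phi> x) p)"
  by unfold_locales
    (simp add: subst_poly_def additive.add[OF \<phi>] additive.add[OF additive_funpow[OF X]] sum.distrib)

lemma funpow_commute: "(\<And>x. Z (X x) = X' (Z x)) \<Longrightarrow> Z ((X ^^ n) x) = (X' ^^ n) (Z x)"
  by (induction n) simp_all

text \<open>An intertwiner \<open>Z\<close> of \<open>X\<close> and \<open>X'\<close> moves inside a substitution. With \<open>X = X'\<close> this is how
  multiplication by \<open>\<lambda>\<close>, \<open>\<mu>\<close> or \<open>\<partial>\<close> is carried through an iterated product.\<close>

lemma subst_poly_fusion:
  assumes "additive Z" and "\<And>x. Z (X x) = X' (Z x)"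
  shows "Z (subst_poly X \<phi> p) = subst_poly X' (\<lambda>r. Z (\<phi> r)) p"
  by (simp add: subst_poly_def additive.sum[OF assms(1)]
      funpow_commute[where X = X and X' = X' and Z = Z, OF assms(2)])

lemma subst_poly_map_poly:
  assumes X: "additive X" and \<phi>: "\<phi> 0 = 0" and f: "f 0 = 0"
  shows "subst_poly X \<phi> (map_poly f p) = subst_poly X (\<lambda>r. \<phi> (f r)) p"
proof -
  have "subst_poly X \<phi> (map_poly f p)
      = (\<Sum>i\<le>degree p. (X ^^ i) (\<phi> (coeff (map_poly f p) i)))"
    by (rule subst_poly_eq_sum[where X = X and \<phi> = \<phi>, OF X \<phi>]) (simp add: map_poly_degree_leq f)
  then show ?thesis
    by (simp add: subst_poly_def coeff_map_poly f)
qed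

lemma subst_op_eq: "subst_op X = subst_poly X (\<lambda>r. [:[:r:]:])"
  by (simp add: fun_eq_iff subst_op_def subst_poly_def)

lemma lprod_poly_left_eq:
  "lprod_poly_left lprod X Y P c = subst_poly X (\<lambda>r. subst_op Y (lprod r c)) P"
  by (simp add: lprod_poly_left_def subst_poly_def)

lemma lprod_poly_right_eq:
  "lprod_poly_right lprod X Y a P = subst_poly Y (\<lambda>r. subst_op X (lprod a r)) P"
  by (simp add: lprod_poly_right_def subst_poly_def)

lemma additive_const_const: "additive (\<lambda>r::'r::ab_group_add. [:[:r:]:])"
  by (simp add: additive_def)

lemma additive_subst_op: "additive X \<Longrightarrow> additive (subst_op X)"
  by (simp add: subst_op_eq additive_subst_poly additive_const_const)

lemma subst_op_0 [simp]: "subst_op X 0 = 0"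
  by (simp add: subst_op_def)

lemma subst_op_pCons:
  fixes a :: "'r::ab_group_add"
  shows "additive X \<Longrightarrow> subst_op X (pCons a p) = [:[:a:]:] + X (subst_op X p)"
  by (simp add: subst_op_eq subst_poly_pCons)

section \<open>The left-symmetry defect of a sesquilinear product\<close>

text \<open>A \<open>\<lambda>\<close>-product without the left-symmetry axiom, over an abelian group with an endomorphism
  \<open>d\<close> in the role of \<open>\<partial>\<close>: this is the structure that reduces left symmetry to generators.\<close>

locale sesquilinear_product =
  fixes d :: "'r::ab_group_add \<Rightarrow> 'r" and lprod :: "'r \<Rightarrow> 'r \<Rightarrow> 'r poly"
  assumes additive_d: "additive d"
    and additive_left: "\<And>b. additive (\<lambda>a. lprod a b)"
    and additive_right: "\<And>a. additive (lprod a)"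
    and lprod_d_left: "lprod (d a) b = - pCons 0 (lprod a b)"
    and lprod_d_right: "lprod a (d b) = map_poly d (lprod a b) + pCons 0 (lprod a b)"
begin

abbreviation D :: "'r poly poly \<Rightarrow> 'r poly poly"
  where "D \<equiv> map_poly (map_poly d)"

lemma additive_D: "additive D"
  by (intro additive_map_poly additive_d)

lemma subst_op_d:
  assumes X: "additive X" and XD: "\<And>x. D (X x) = X (D x)"
  shows "subst_op X (map_poly d p) = D (subst_op X p)"
proof -
  have "D (subst_op X p) = subst_poly X (\<lambda>r. D [:[:r:]:]) p"
    unfolding subst_op_eq by (rule subst_poly_fusion[where X = X and X' = X and Z = D, OF additive_D XD])
  also have "\<dots> = subst_op X (map_poly d p)"
    unfolding subst_op_eq
    by (simp add: subst_poly_map_poly X additive.zero additive_d map_poly_pCons)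
  finally show ?thesis by simp
qed

lemma subst_op_lprod_d_left:
  assumes X: "additive X"
  shows "subst_op X (lprod (d a) b) = - X (subst_op X (lprod a b))"
  by (simp add: lprod_d_left additive.minus additive_subst_op X subst_op_pCons del: minus_pCons)

lemma subst_op_lprod_d_right:
  assumes X: "additive X" and XD: "\<And>x. D (X x) = X (D x)"
  shows "subst_op X (lprod a (d b)) = D (subst_op X (lprod a b)) + X (subst_op X (lprod a b))"
  by (simp add: lprod_d_right additive.add[OF additive_subst_op] X subst_op_pCons subst_op_d XD)

lemma additive_subst_op_lprod:
  assumes "additive X"
  shows "additive (\<lambda>a. subst_op X (lprod a b))" and "additive (\<lambda>b. subst_op X (lprod a b))"
  using additive_subst_op[OF assms] additive_left additive_right
  by (simp_all add: additive_def)

lemmas subst_op_lprod_zero = additive_subst_op_lprod[THEN additive.zero]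

lemma additive_lprod_poly_left:
  assumes "additive X" "additive Y"
  shows "additive (\<lambda>P. lprod_poly_left lprod X Y P c)"
    and "additive (lprod_poly_left lprod X Y P)"
  unfolding lprod_poly_left_eq
  by (intro additive_subst_poly additive_subst_poly_fun additive_subst_op_lprod assms)+

lemma additive_lprod_poly_right:
  assumes "additive X" "additive Y"
  shows "additive (lprod_poly_right lprod X Y a)"
    and "additive (\<lambda>a. lprod_poly_right lprod X Y a P)"
  unfolding lprod_poly_right_eq
  by (intro additive_subst_poly additive_subst_poly_fun additive_subst_op_lprod assms)+

text \<open>Sesquilinearity of the iterated products. The operators stand for the formal variables that
  the products carry, which is why they commute with each other and with \<open>\<partial>\<close>.\<close>

context
  fixes X Y :: "'r poly poly \<Rightarrow> 'r poly poly"
  assumes X: "additive X" and Y: "additive Y"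
    and XY: "\<And>x. X (Y x) = Y (X x)"
    and XD: "\<And>x. D (X x) = X (D x)" and YD: "\<And>x. D (Y x) = Y (D x)"
begin

lemma lprod_poly_left_pCons:
  "lprod_poly_left lprod X Y (pCons 0 P) c = X (lprod_poly_left lprod X Y P c)"
  by (simp add: lprod_poly_left_eq subst_poly_pCons X
      subst_op_lprod_zero[OF X] subst_op_lprod_zero[OF Y])

text \<open>Applying \<open>\<partial>\<close> to the coefficients of \<open>P\<close> multiplies every inner product by \<open>-Y\<close>, and the
  factor \<open>-Y\<close> can be pulled out because it commutes with \<open>X\<close>.\<close>

lemma lprod_poly_left_d:
  "lprod_poly_left lprod X Y (map_poly d P) c = - Y (lprod_poly_left lprod X Y P c)"
proof -
  have "additive (\<lambda>x. - Y x)" by (simp add: additive_uminus Y)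
  then have "- Y (lprod_poly_left lprod X Y P c)
      = subst_poly X (\<lambda>r. - Y (subst_op Y (lprod r c))) P"
    unfolding lprod_poly_left_eq
    by (rule subst_poly_fusion) (simp add: XY additive.minus X)
  also have "\<dots> = lprod_poly_left lprod X Y (map_poly d P) c"
    by (simp add: lprod_poly_left_eq subst_poly_map_poly X
        subst_op_lprod_zero[OF X] subst_op_lprod_zero[OF Y] additive.zero additive_d
        subst_op_lprod_d_left Y)
  finally show ?thesis by simp
qed

lemma lprod_poly_left_d_right:
  "lprod_poly_left lprod X Y P (d c)
    = D (lprod_poly_left lprod X Y P c) + Y (lprod_poly_left lprod X Y P c)"
proof -
  have "additive (\<lambda>x. D x + Y x)" by (simp add: additive_add Y additive_D)
  then have "D (lprod_poly_left lprod X Y P c) + Y (lprod_poly_left lprod X Y P c)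
      = subst_poly X (\<lambda>r. D (subst_op Y (lprod r c)) + Y (subst_op Y (lprod r c))) P"
    unfolding lprod_poly_left_eq
    by (rule subst_poly_fusion) (simp add: XY XD additive.add X)
  then show ?thesis
    by (simp add: lprod_poly_left_eq subst_op_lprod_d_right Y YD)
qed

lemma lprod_poly_right_pCons:
  "lprod_poly_right lprod X Y a (pCons 0 P) = Y (lprod_poly_right lprod X Y a P)"
  by (simp add: lprod_poly_right_eq subst_poly_pCons Y
      subst_op_lprod_zero[OF X] subst_op_lprod_zero[OF Y])

lemma lprod_poly_right_d:
  "lprod_poly_right lprod X Y a (map_poly d P)
    = D (lprod_poly_right lprod X Y a P) + X (lprod_poly_right lprod X Y a P)"
proof -
  have "additive (\<lambda>x. D x + X x)" by (simp add: additive_add X additive_D)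
  then have "D (lprod_poly_right lprod X Y a P) + X (lprod_poly_right lprod X Y a P)
      = subst_poly Y (\<lambda>r. D (subst_op X (lprod a r)) + X (subst_op X (lprod a r))) P"
    unfolding lprod_poly_right_eq
    by (rule subst_poly_fusion) (simp add: XY YD additive.add Y)
  also have "\<dots> = lprod_poly_right lprod X Y a (map_poly d P)"
    by (simp add: lprod_poly_right_eq subst_poly_map_poly Y
        subst_op_lprod_zero[OF X] subst_op_lprod_zero[OF Y] additive.zero additive_d
        subst_op_lprod_d_right X XD)
  finally show ?thesis by simp
qed

lemma lprod_poly_right_d_left:
  "lprod_poly_right lprod X Y (d a) P = - X (lprod_poly_right lprod X Y a P)"
proof -
  have "additive (\<lambda>x. - X x)" by (simp add: additive_uminus X)
  then have "- X (lprod_poly_right lprod X Y a P)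
      = subst_poly Y (\<lambda>r. - X (subst_op X (lprod a r))) P"
    unfolding lprod_poly_right_eq
    by (rule subst_poly_fusion) (simp add: XY additive.minus Y)
  then show ?thesis
    by (simp add: lprod_poly_right_eq subst_op_lprod_d_left X)
qed

end

abbreviation L :: "'r poly poly \<Rightarrow> 'r poly poly" where "L \<equiv> pCons 0"
abbreviation M :: "'r poly poly \<Rightarrow> 'r poly poly" where "M \<equiv> map_poly (pCons 0)"
abbreviation LM :: "'r poly poly \<Rightarrow> 'r poly poly" where "LM \<equiv> \<lambda>q. L q + M q"

lemma operators:
  "additive L" "additive M" "additive LM"
  "L (M x) = M (L x)" "M (L x) = L (M x)"
  "D (L x) = L (D x)" "D (M x) = M (D x)"
proof -
  have d0: "d 0 = 0" by (rule additive.zero[OF additive_d])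
  show "additive L" "additive M" "additive LM"
    by (intro additive_pCons additive_map_poly additive_add)+
  show "L (M x) = M (L x)" "M (L x) = L (M x)"
    by (simp_all add: map_poly_pCons)
  show "D (L x) = L (D x)" by (simp add: map_poly_pCons)
  show "D (M x) = M (D x)"
    by (simp add: map_poly_map_poly o_def map_poly_pCons d0)
qed

text \<open>For \<open>X, Y = \<lambda>, \<mu>\<close> this is \<open>(a\<^sub>\<lambda> b)\<^bsub>\<lambda>+\<mu>\<^esub> c - a\<^sub>\<lambda> (b\<^sub>\<mu> c)\<close>; exchanging the two operators
  gives the associator on the other side of the left-symmetry axiom.\<close>

definition conformal_associator where
  "conformal_associator X Y a b c =
     lprod_poly_left lprod X LM (lprod a b) c - lprod_poly_right lprod X Y a (lprod b c)"

lemma additive_conformal_associator: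
  assumes X: "additive X" and Y: "additive Y"
  shows "additive (\<lambda>a. conformal_associator X Y a b c)"
    and "additive (\<lambda>b. conformal_associator X Y a b c)"
    and "additive (\<lambda>c. conformal_associator X Y a b c)"
  using additive_lprod_poly_left[OF X operators(3)] additive_lprod_poly_right[OF X Y]
    additive_left additive_right
  by (simp_all add: additive_def conformal_associator_def)

text \<open>Both terms of the associator pick up the same factor: \<open>\<partial>\<close> on \<open>a\<close> gives \<open>-X\<close> and on \<open>c\<close>
  gives \<open>\<partial> + X + Y\<close>. On \<open>b\<close> the left term gets \<open>X - (X + Y)\<close>, since \<open>a\<^sub>X (\<partial> b)\<close> equals \<open>(\<partial> + X)
  (a\<^sub>X b)\<close> and the outer product turns \<open>\<partial>\<close> into \<open>-(X + Y)\<close>; this is the \<open>-Y\<close> of the right term.\<close>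

lemma conformal_associator_d:
  assumes X: "additive X" and Y: "additive Y"
    and sum: "LM = (\<lambda>x. X x + Y x)"
    and XY: "\<And>x. X (Y x) = Y (X x)"
    and XD: "\<And>x. D (X x) = X (D x)" and YD: "\<And>x. D (Y x) = Y (D x)"
  shows "conformal_associator X Y (d a) b c = - X (conformal_associator X Y a b c)"
    and "conformal_associator X Y a (d b) c = - Y (conformal_associator X Y a b c)"
    and "conformal_associator X Y a b (d c)
      = D (conformal_associator X Y a b c) + LM (conformal_associator X Y a b c)"
proof -
  have XLM: "X (X x + Y x) = X (X x) + Y (X x)" for x
    by (simp add: additive.add[OF X] XY)
  have DLM: "D (X x + Y x) = X (D x) + Y (D x)" for x
    by (simp add: additive.add[OF additive_D] XD YD)
  have XpY: "additive (\<lambda>x. X x + Y x)" by (intro additive_add X Y)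
  note left = lprod_poly_left_d lprod_poly_left_pCons lprod_poly_left_d_right
  note right = lprod_poly_right_d_left lprod_poly_right_pCons lprod_poly_right_d
  note l = left[where X = X and Y = "\<lambda>x. X x + Y x", OF X XpY XLM XD DLM]
  note r = right[where X = X and Y = Y, OF X Y XY XD YD]
  note addl = additive_lprod_poly_left[OF X XpY]
  note addr = additive_lprod_poly_right[OF X Y]
  note adds = additive.add[OF addl(1)] additive.minus[OF addl(1)]
    additive.add[OF addr(1)] additive.minus[OF addr(1)]
    additive.diff[OF X] additive.diff[OF Y] additive.diff[OF additive_D]
  show "conformal_associator X Y (d a) b c = - X (conformal_associator X Y a b c)"
    unfolding conformal_associator_def sum lprod_d_left lprod_d_right
    by (simp add: l r adds del: minus_pCons)
  show "conformal_associator X Y a (d b) c = - Y (conformal_associator X Y a b c)"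
    unfolding conformal_associator_def sum lprod_d_left lprod_d_right
    by (simp add: l r adds del: minus_pCons)
  show "conformal_associator X Y a b (d c)
      = D (conformal_associator X Y a b c) + LM (conformal_associator X Y a b c)"
    unfolding conformal_associator_def sum lprod_d_left lprod_d_right
    by (simp add: l r adds fun_cong[OF sum] del: minus_pCons)
qed

definition symmetry_defect where
  "symmetry_defect a b c = conformal_associator L M a b c - conformal_associator M L b a c"

text \<open>The two associators are scaled alike, so the zeros of the defect are stable under \<open>\<partial>\<close> in
  each argument. This is what reduces left symmetry to generators.\<close>

lemma symmetry_defect_d:
  "symmetry_defect (d a) b c = - L (symmetry_defect a b c)"
  "symmetry_defect a (d b) c = - M (symmetry_defect a b c)"
  "symmetry_defect a b (d c) = D (symmetry_defect a b c) + LM (symmetry_defect a b c)"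
  unfolding symmetry_defect_def additive.diff[OF additive_D] additive.diff[OF operators(1)]
    additive.diff[OF operators(2)]
  by (subst conformal_associator_d[where X = L and Y = M]; (intro operators refl)?;
      subst conformal_associator_d[where X = M and Y = L]; (intro operators add.commute ext)?;
      simp)+

lemma additive_symmetry_defect:
  "additive (\<lambda>a. symmetry_defect a b c)"
  "additive (\<lambda>b. symmetry_defect a b c)"
  "additive (\<lambda>c. symmetry_defect a b c)"
  unfolding symmetry_defect_def
  by (intro additive_diff additive_conformal_associator operators)+

end

section \<open>The free module over the polynomial ring\<close>

lemma pCons_split: "pCons (a::'a::ab_group_add) f = [:a:] + pCons 0 f"
  by simp

text \<open>\<open>\<complex>[\<partial>]V\<close> is generated by \<open>V\<close> under addition and \<open>\<partial>\<close>.\<close>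

lemma additive_eq_0_polyI:
  fixes J :: "'a::ab_group_add poly \<Rightarrow> 'b::ab_group_add"
  assumes J: "additive J" and gen: "\<And>a. J [:a:] = 0" and step: "\<And>f. J f = 0 \<Longrightarrow> J (pCons 0 f) = 0"
  shows "J f = 0"
proof (induction f)
  case 0
  show ?case by (rule additive.zero[OF J])
next
  case (pCons a f)
  then show ?case
    unfolding pCons_split[of a f] by (simp only: additive.add[OF J] gen step) simp
qed

lemma module_map_poly: "module s \<Longrightarrow> module (\<lambda>z. map_poly (s z))"
  by (simp add: module_def poly_eq_iff coeff_map_poly
      module.scale_zero_right[unfolded module_def])

text \<open>Polynomials in \<open>\<partial>\<close> have complex coefficients, so the scalars of \<open>V\<close> are fixed to be
  complex here.\<close>

locale complex_vector_space = vector_space scale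
  for scale :: "complex \<Rightarrow> 'a::ab_group_add \<Rightarrow> 'a"
begin

lemma additive_scale: "additive (scale z)"
  by (simp add: additive_def scale_right_distrib)

lemma free_scale_eq: "free_scale scale p f = subst_poly (pCons 0) (\<lambda>z. map_poly (scale z) f) p"
  by (simp add: free_scale_def subst_poly_def)

lemma additive_coefficient_scale: "additive (\<lambda>z. map_poly (scale z) f)"
  by (simp add: additive_def poly_eq_iff coeff_map_poly scale_left_distrib)

lemma free_scale_pCons:
  "free_scale scale (pCons z p) f = map_poly (scale z) f + pCons 0 (free_scale scale p f)"
  by (simp add: free_scale_eq subst_poly_pCons additive_pCons additive.zero[OF
      additive_coefficient_scale])

lemma free_scale_0 [simp]: "free_scale scale 0 f = 0"
  by (simp add: free_scale_eq subst_poly_0 additive.zero[OF additive_coefficient_scale])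

lemma free_scale_const: "free_scale scale [:z:] = map_poly (scale z)"
  by (simp add: fun_eq_iff free_scale_pCons)

lemma map_poly_scale_1 [simp]: "map_poly (scale 1) f = f"
  by (simp add: poly_eq_iff coeff_map_poly)

lemma map_poly_scale_0 [simp]: "map_poly (scale 0) f = 0"
  by (simp add: poly_eq_iff coeff_map_poly)

lemma free_scale_indeterminate: "free_scale scale [:0, 1:] = pCons 0"
  by (simp add: fun_eq_iff free_scale_pCons)

lemma free_scale_smult:
  "free_scale scale (smult z p) f = map_poly (scale z) (free_scale scale p f)"
proof -
  have "map_poly (scale z) (free_scale scale p f)
      = subst_poly (pCons 0) (\<lambda>y. map_poly (scale z) (map_poly (scale y) f)) p"
    unfolding free_scale_eq
    by (rule subst_poly_fusion)
      (simp_all add: additive_map_poly additive_scale map_poly_pCons)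
  then show ?thesis
    by (simp add: free_scale_eq smult_conv_map_poly subst_poly_map_poly additive_pCons
        map_poly_map_poly o_def)
qed

lemma module_free_scale: "module (free_scale scale)"
proof
  fix p q :: "complex poly" and f g :: "'a poly"
  show add_left: "free_scale scale (p + q) f = free_scale scale p f + free_scale scale q f" for p q
    unfolding free_scale_eq
    by (intro additive.add additive_subst_poly additive_pCons additive_coefficient_scale)
  show add_right: "free_scale scale p (f + g) = free_scale scale p f + free_scale scale p g" for f g
    unfolding free_scale_eq
    by (rule additive.add[OF additive_subst_poly_fun])
      (intro additive_pCons additive_map_poly additive_scale)+
  show "free_scale scale p (free_scale scale q f) = free_scale scale (p * q) f"
    by (induction p) (simp_all add: free_scale_pCons free_scale_smult add_left)
  show "free_scale scale 1 f = f"
    by (simp add: one_pCons free_scale_const)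
qed

end

section \<open>The quadratic product is a left-symmetric conformal product\<close>

context pre_gelfand_dorfman_algebra
begin

sublocale complex_vector_space scale ..

abbreviation gen :: "'a \<Rightarrow> 'a \<Rightarrow> 'a poly poly"
  where "gen \<equiv> quadratic_gen (\<lhd>) (\<rhd>) (\<odot>)"

abbreviation lprod :: "'a poly \<Rightarrow> 'a poly \<Rightarrow> 'a poly poly"
  where "lprod \<equiv> quadratic_lprod (\<lhd>) (\<rhd>) (\<odot>)"

lemma bilinear_simps:
  "(x + y) \<lhd> z = x \<lhd> z + y \<lhd> z" "x \<lhd> (y + z) = x \<lhd> y + x \<lhd> z"
  "(x + y) \<rhd> z = x \<rhd> z + y \<rhd> z" "x \<rhd> (y + z) = x \<rhd> y + x \<rhd> z"
  "(x + y) \<odot> z = x \<odot> z + y \<odot> z" "x \<odot> (y + z) = x \<odot> y + x \<odot> z"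
  "scale t x \<lhd> z = scale t (x \<lhd> z)" "x \<lhd> scale t z = scale t (x \<lhd> z)"
  "scale t x \<rhd> z = scale t (x \<rhd> z)" "x \<rhd> scale t z = scale t (x \<rhd> z)"
  "scale t x \<odot> z = scale t (x \<odot> z)" "x \<odot> scale t z = scale t (x \<odot> z)"
  using bilinear_lhd bilinear_rhd bilinear_lsa
  by (simp_all add: module_bilinear_def module_hom_iff)

lemma additive_ops:
  "additive (\<lambda>x. x \<lhd> y)" "additive ((\<lhd>) x)"
  "additive (\<lambda>x. x \<rhd> y)" "additive ((\<rhd>) x)"
  "additive (\<lambda>x. x \<odot> y)" "additive ((\<odot>) x)"
  by (simp_all add: additive_def bilinear_simps)

lemmas zero_minus_simps [simp] = additive_ops[THEN additive.zero] additive_ops[THEN additive.minus]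
lemmas diff_simps = additive_ops[THEN additive.diff]

lemma additive_gen: "additive (\<lambda>a. gen a b)" "additive (gen a)"
  by (simp_all add: additive_def quadratic_gen_def bilinear_simps add_ac)

lemmas gen_0 [simp] = additive_gen[THEN additive.zero]

lemma additive_operators:
  "additive (\<lambda>q::'a poly poly. - pCons 0 q)"
  "additive (\<lambda>q::'a poly poly. pCons 0 q + map_poly (pCons 0) q)"
  "additive (map_poly (pCons 0) :: 'a poly poly \<Rightarrow> _)"
  by (intro additive_uminus additive_add additive_map_poly additive_pCons)+

lemma lprod_eq:
  "lprod f g = subst_poly (\<lambda>q. - pCons 0 q)
    (\<lambda>v. subst_poly (\<lambda>q. pCons 0 q + map_poly (pCons 0) q) (gen v) g) f"
  by (simp only: quadratic_lprod_def subst_poly_def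
      additive.sum[OF additive_funpow[OF additive_operators(1)]])

lemma additive_lprod: "additive (\<lambda>f. lprod f g)" "additive (lprod f)"
  unfolding lprod_eq
  by (intro additive_subst_poly additive_subst_poly_fun additive_operators additive_gen)+

lemmas lprod_0 [simp] = additive_lprod[THEN additive.zero]

lemma lprod_shift_left: "lprod (pCons 0 f) g = - pCons 0 (lprod f g)"
proof -
  let ?inner = "\<lambda>v. subst_poly (\<lambda>q. pCons 0 q + map_poly (pCons 0) q) (gen v) g"
  have "additive ?inner"
    by (intro additive_subst_poly_fun additive_operators additive_gen)
  then have "?inner 0 = 0"
    by (rule additive.zero)
  then show ?thesis
    unfolding lprod_eq
    by (subst subst_poly_pCons[OF additive_operators(1)]) (simp_all only: add_0_left)
qed

lemma lprod_shift_right: "lprod f (pCons 0 g) = map_poly (pCons 0) (lprod f g) + pCons 0 (lprod f g)"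
proof -
  let ?LM = "\<lambda>q. pCons 0 q + map_poly (pCons 0) q :: 'a poly poly"
  have "?LM (lprod f g) = subst_poly (\<lambda>q. - pCons 0 q) (\<lambda>v. ?LM (subst_poly ?LM (gen v) g)) f"
    unfolding lprod_eq
    by (rule subst_poly_fusion[OF additive_operators(2)])
      (simp add: additive.minus[OF additive_operators(3)] map_poly_pCons)
  then show ?thesis
    by (simp add: lprod_eq subst_poly_pCons additive_operators add.commute)
qed

sublocale sesquilinear_product "pCons 0" lprod
  by unfold_locales
    (simp_all only: lprod_shift_left lprod_shift_right additive.add[OF additive_lprod(1)]
       additive.add[OF additive_lprod(2)] additive.add[OF additive_pCons])

lemma lprod_const_const: "lprod [:a:] [:b:] = gen a b"
  by (simp add: lprod_eq)

lemma lprod_pCons_left: "lprod (pCons a f) g = lprod [:a:] g - pCons 0 (lprod f g)"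
  unfolding pCons_split[of a f] additive.add[OF additive_lprod(1)] lprod_shift_left by simp

lemma lprod_pCons_right:
  "lprod f (pCons b g) = lprod f [:b:] + (map_poly (pCons 0) (lprod f g) + pCons 0 (lprod f g))"
  unfolding pCons_split[of b g] additive.add[OF additive_lprod(2)] lprod_shift_right by simp

lemma lprod_linear_const:
 "lprod [:a, b:] [:c:] = gen a c - pCons 0 (gen b c)"
 "lprod [:c:] [:a, b:] = gen c a + (map_poly (pCons 0) (gen c b) + pCons 0 (gen c b))"
  by (simp_all add: lprod_pCons_left[of a "[:b:]"] lprod_pCons_right[of _ a "[:b:]"] lprod_const_const)

text \<open>The axioms solved for a single term, so that instances of them can be used as rewrite
  rules in an abelian group.\<close>

context
  fixes a b c :: 'a
begin

lemma pre_novikov_1_solved: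
  "a \<rhd> (b \<rhd> c) = (a \<rhd> b) \<rhd> c + (a \<lhd> b) \<rhd> c + b \<rhd> (a \<rhd> c)
    - (b \<rhd> a) \<rhd> c - (b \<lhd> a) \<rhd> c"
  using pre_novikov_1[of a b c] by (simp add: bilinear_simps algebra_simps)

lemma pre_novikov_2_solved:
  "a \<rhd> (b \<lhd> c) = (a \<rhd> b) \<lhd> c + b \<lhd> (a \<lhd> c) + b \<lhd> (a \<rhd> c) - (b \<lhd> a) \<lhd> c"
  using pre_novikov_2[of a b c] by (simp add: bilinear_simps algebra_simps)

lemma pre_novikov_3_solved: "(a \<rhd> b) \<rhd> c = (a \<rhd> c) \<lhd> b - (a \<lhd> b) \<rhd> c"
  using pre_novikov_3[of a b c] by (simp add: bilinear_simps algebra_simps)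

lemma pre_gelfand_dorfman_1_solved:
  "c \<lhd> (a \<odot> b) = c \<lhd> (b \<odot> a) + a \<odot> (c \<lhd> b) + (b \<odot> c) \<lhd> a
    - b \<odot> (c \<lhd> a) - (a \<odot> c) \<lhd> b"
  using pre_gelfand_dorfman_1[of c a b] by (simp add: bilinear_simps diff_simps algebra_simps)

lemma pre_gelfand_dorfman_2_solved:
  "(a \<odot> b) \<rhd> c = (b \<odot> a) \<rhd> c + a \<rhd> (b \<odot> c) + (a \<odot> c) \<lhd> b
    - b \<odot> (a \<rhd> c) - (a \<lhd> b) \<odot> c - (a \<rhd> b) \<odot> c"
  using pre_gelfand_dorfman_2[of a b c] by (simp add: bilinear_simps diff_simps algebra_simps)

end

text \<open>On generators the defect is a polynomial of degree at most two in \<open>\<lambda>\<close>, \<open>\<mu>\<close>, \<open>\<partial>\<close>, and each of its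
  ten coefficients vanishes by the axioms: the constant term is left symmetry of \<open>\<odot>\<close>, the
  linear terms follow from the two compatibility conditions, and the quadratic terms from the
  pre-Novikov identities.\<close>

lemma symmetry_defect_gen:
  "symmetry_defect [:a:] [:b:] [:c:] = 0"
proof -
  have left: "lprod_poly_left lprod X LM [:p, q:] h
      = subst_op LM (lprod p h) + X (subst_op LM (lprod q h))"
    if "additive X" for X p q h
    by (simp add: lprod_poly_left_eq subst_poly_pCons[OF that] subst_op_lprod_zero[OF operators(3)])
  have right: "lprod_poly_right lprod X Y f [:p, q:]
      = subst_op X (lprod f p) + Y (subst_op X (lprod f q))"
    if "additive X" "additive Y" for X Y p q f
    by (simp add: lprod_poly_right_eq subst_poly_pCons[OF that(2)] subst_op_lprod_zero[OF that(1)])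
  have L: "additive L" and M: "additive M" by (rule operators)+
  show ?thesis
    unfolding symmetry_defect_def conformal_associator_def lprod_const_const
    unfolding quadratic_gen_def left[OF L] left[OF M] right[OF L M] right[OF M L]
  proof (simp add: lprod_const_const lprod_linear_const quadratic_gen_def map_poly_pCons
       subst_op_pCons[OF operators(3)] subst_op_pCons[OF L] subst_op_pCons[OF M]
       additive.zero[OF additive_subst_op] operators(1-3),
      intro conjI)
    (* The coefficients of 1, \<partial>, \<partial>^2, \<mu>, \<mu>\<partial>, \<mu>^2, \<lambda>, \<lambda>\<partial>, \<lambda>\<mu>, \<lambda>^2, in this order. *)
    show "a \<odot> b \<odot> c - a \<odot> (b \<odot> c) = b \<odot> a \<odot> c - b \<odot> (a \<odot> c)"
      by (rule left_symmetric)
    show "c \<lhd> (a \<odot> b) - (b \<odot> c \<lhd> a + a \<odot> (c \<lhd> b))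
        = c \<lhd> (b \<odot> a) - (a \<odot> c \<lhd> b + b \<odot> (c \<lhd> a))"
      using pre_gelfand_dorfman_1_solved[of c a b] by (simp add: algebra_simps)
    show "c \<lhd> a \<lhd> b = c \<lhd> b \<lhd> a"
      by (rule pre_novikov_4)
    show "a \<odot> b \<rhd> c + c \<lhd> (a \<odot> b) - b \<lhd> a \<odot> c - a \<odot> (b \<rhd> c + c \<lhd> b)
        = b \<odot> a \<rhd> c + c \<lhd> (b \<odot> a) - a \<lhd> b \<odot> c + (b \<rhd> a + a \<lhd> b) \<odot> c
          - (b \<rhd> (a \<odot> c) + a \<odot> c \<lhd> b + b \<odot> (c \<lhd> a))"
      by (simp add: bilinear_simps pre_gelfand_dorfman_1_solved[of c a b]
          pre_gelfand_dorfman_2_solved[of b a c] algebra_simps)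
    show "- (c \<lhd> (b \<lhd> a)) - (b \<rhd> c + c \<lhd> b) \<lhd> a
        = c \<lhd> (b \<rhd> a + a \<lhd> b) - c \<lhd> (a \<lhd> b) - (b \<rhd> (c \<lhd> a) + c \<lhd> a \<lhd> b + c \<lhd> a \<lhd> b)"
      by (simp add: bilinear_simps pre_novikov_2_solved[of b c a] pre_novikov_4[of c a b] algebra_simps)
    show "- (b \<lhd> a \<rhd> c) - c \<lhd> (b \<lhd> a)
        = - (a \<lhd> b \<rhd> c) - c \<lhd> (a \<lhd> b) + ((b \<rhd> a + a \<lhd> b) \<rhd> c + c \<lhd> (b \<rhd> a + a \<lhd> b))
          - (b \<rhd> (c \<lhd> a) + c \<lhd> a \<lhd> b)"
      by (simp add: bilinear_simps pre_novikov_2_solved[of b c a] pre_novikov_3_solved[of b a c]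
          pre_novikov_4[of c a b] algebra_simps)
    show "a \<odot> b \<rhd> c + c \<lhd> (a \<odot> b) - b \<lhd> a \<odot> c + (a \<rhd> b + b \<lhd> a) \<odot> c
          - (a \<rhd> (b \<odot> c) + b \<odot> c \<lhd> a + a \<odot> (c \<lhd> b))
        = b \<odot> a \<rhd> c + c \<lhd> (b \<odot> a) - a \<lhd> b \<odot> c - b \<odot> (a \<rhd> c + c \<lhd> a)"
      by (simp add: bilinear_simps pre_gelfand_dorfman_1_solved[of c a b]
          pre_gelfand_dorfman_2_solved[of a b c] algebra_simps)
    show "c \<lhd> (a \<rhd> b + b \<lhd> a) - c \<lhd> (b \<lhd> a) - (a \<rhd> (c \<lhd> b) + c \<lhd> b \<lhd> a + c \<lhd> b \<lhd> a)
        = - (c \<lhd> (a \<lhd> b)) - (a \<rhd> c + c \<lhd> a) \<lhd> b"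
      by (simp add: bilinear_simps pre_novikov_2_solved[of a c b] pre_novikov_4[of c a b] algebra_simps)
    show "- (b \<lhd> a \<rhd> c) - c \<lhd> (b \<lhd> a) + (- (b \<lhd> a \<rhd> c) - c \<lhd> (b \<lhd> a))
          + ((a \<rhd> b + b \<lhd> a) \<rhd> c + c \<lhd> (a \<rhd> b + b \<lhd> a))
          - (a \<rhd> (b \<rhd> c + c \<lhd> b) + (b \<rhd> c + c \<lhd> b) \<lhd> a)
        = - (a \<lhd> b \<rhd> c) - c \<lhd> (a \<lhd> b) + (- (a \<lhd> b \<rhd> c) - c \<lhd> (a \<lhd> b))
          + ((b \<rhd> a + a \<lhd> b) \<rhd> c + c \<lhd> (b \<rhd> a + a \<lhd> b))
          - (b \<rhd> (a \<rhd> c + c \<lhd> a) + (a \<rhd> c + c \<lhd> a) \<lhd> b)"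
      by (simp add: bilinear_simps pre_novikov_1_solved[of a b c] pre_novikov_2_solved[of a c b]
          pre_novikov_2_solved[of b c a] pre_novikov_3_solved[of a b c]
          pre_novikov_3_solved[of b a c] pre_novikov_4[of c a b] algebra_simps)
    show "- (b \<lhd> a \<rhd> c) - c \<lhd> (b \<lhd> a) + ((a \<rhd> b + b \<lhd> a) \<rhd> c + c \<lhd> (a \<rhd> b + b \<lhd> a))
          - (a \<rhd> (c \<lhd> b) + c \<lhd> b \<lhd> a)
        = - (a \<lhd> b \<rhd> c) - c \<lhd> (a \<lhd> b)"
      by (simp add: bilinear_simps pre_novikov_2_solved[of a c b] pre_novikov_3_solved[of a b c]
          pre_novikov_4[of c a b] algebra_simps)
  qed
qed

lemma symmetry_defect_eq_0: "symmetry_defect f g h = 0"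
proof -
  note shifts = symmetry_defect_d operators(1-3)[THEN additive.zero] additive.zero[OF additive_D]
  have on_gen2: "symmetry_defect [:a:] [:b:] h = 0" for a b h
    by (rule additive_eq_0_polyI[OF additive_symmetry_defect(3)])
      (simp_all add: symmetry_defect_gen shifts)
  have on_gen1: "symmetry_defect [:a:] g h = 0" for a g h
    by (rule additive_eq_0_polyI[OF additive_symmetry_defect(2)]) (simp_all add: on_gen2 shifts)
  show ?thesis
    by (rule additive_eq_0_polyI[OF additive_symmetry_defect(1)]) (simp_all add: on_gen1 shifts)
qed

lemma lprod_scale:
  "lprod (map_poly (scale z) f) g = map_poly (map_poly (scale z)) (lprod f g)"
  "lprod f (map_poly (scale z) g) = map_poly (map_poly (scale z)) (lprod f g)"
proof -
  let ?z = "map_poly (map_poly (scale z)) :: 'a poly poly \<Rightarrow> _"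
  let ?L = "\<lambda>q::'a poly poly. - pCons 0 q"
  let ?LM = "\<lambda>q::'a poly poly. pCons 0 q + map_poly (pCons 0) q"
  have z: "additive ?z"
    by (intro additive_map_poly additive_scale)
  have "?z (map_poly (pCons 0) q) = map_poly (pCons 0) (?z q)" for q
    by (simp add: map_poly_map_poly o_def map_poly_pCons)
  then have commute: "?z (?L q) = ?L (?z q)" "?z (?LM q) = ?LM (?z q)" for q
    using additive.minus[OF z] additive.add[OF z] by (simp_all add: map_poly_pCons)
  have gen_left: "gen (scale z a) = (\<lambda>b. ?z (gen a b))" for a
    by (simp add: fun_eq_iff quadratic_gen_def map_poly_pCons bilinear_simps scale_right_distrib)
  have gen_right: "gen a (scale z b) = ?z (gen a b)" for a b
    by (simp add: quadratic_gen_def map_poly_pCons bilinear_simps scale_right_distrib)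
  have "?z (lprod f g) = subst_poly ?L (\<lambda>v. ?z (subst_poly ?LM (gen v) g)) f"
    unfolding lprod_eq by (rule subst_poly_fusion) (rule z commute)+
  moreover have "?z (subst_poly ?LM (gen v) g) = subst_poly ?LM (\<lambda>w. ?z (gen v w)) g" for v
    by (rule subst_poly_fusion) (rule z commute)+
  ultimately have *: "?z (lprod f g) = subst_poly ?L (\<lambda>v. subst_poly ?LM (\<lambda>w. ?z (gen v w)) g) f"
    by simp
  have "additive (\<lambda>v. subst_poly ?LM (gen v) g)"
    by (intro additive_subst_poly_fun additive_operators additive_gen)
  then have inner: "subst_poly ?LM (gen 0) g = 0"
    by (rule additive.zero)
  show "lprod (map_poly (scale z) f) g = ?z (lprod f g)"
    unfolding * unfolding lprod_eq
    by (subst subst_poly_map_poly[OF additive_operators(1)]) (simp_all only: inner gen_left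
        scale_zero_right)
  show "lprod f (map_poly (scale z) g) = ?z (lprod f g)"
    unfolding * unfolding lprod_eq
    by (subst subst_poly_map_poly[OF additive_operators(2)]) (simp_all add: gen_right)
qed

sublocale conformal: left_symmetric_conformal_algebra "free_scale scale" lprod
proof (intro left_symmetric_conformal_algebra.intro left_symmetric_conformal_algebra_axioms.intro)
  show "module (free_scale scale)"
    by (rule module_free_scale)
  have s: "module (\<lambda>z. map_poly (scale z))" by (rule module_map_poly) unfold_locales
  show "module_bilinear (\<lambda>z. free_scale scale [:z:]) (\<lambda>z. free_scale scale [:z:])
      (\<lambda>z. map_poly (free_scale scale [:z:])) lprod"
    by (simp add: module_bilinear_def module_hom_iff free_scale_const s module_map_poly[OF s] lprod_scale
        additive.add[OF additive_left] additive.add[OF additive_right])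
  show "lprod (free_scale scale [:0, 1:] f) g = - pCons 0 (lprod f g)" for f g
    by (simp only: free_scale_indeterminate lprod_shift_left)
  show "lprod f (free_scale scale [:0, 1:] g)
      = map_poly (free_scale scale [:0, 1:]) (lprod f g) + pCons 0 (lprod f g)" for f g
    by (simp only: free_scale_indeterminate lprod_shift_right)
  show "lprod_poly_left lprod L LM (lprod f g) h - lprod_poly_right lprod L M f (lprod g h)
      = lprod_poly_left lprod M LM (lprod g f) h - lprod_poly_right lprod M L g (lprod f h)" for f g h
    using symmetry_defect_eq_0[of f g h]
    by (simp only: symmetry_defect_def conformal_associator_def right_minus_eq)
qed

section \<open>Simplicity\<close>

text \<open>Only the top term \<open>\<partial>\<^sup>k v\<close> of \<open>f\<close> reaches \<open>\<lambda>\<^sup>k\<^sup>+\<^sup>1\<close>: it is multiplied by \<open>(-\<lambda>)\<^sup>k\<close>, which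
  explains the sign, and one more \<open>\<lambda>\<close> comes from the generator formula.\<close>

lemma coeff_lprod_const_right:
  "degree f \<le> k \<Longrightarrow> coeff (lprod f [:b:]) (Suc k)
     = (if even k then id else uminus) [:coeff f k \<rhd> b + b \<lhd> coeff f k:]"
proof (induction f arbitrary: k)
  case 0
  show ?case by simp
next
  case (pCons v f)
  show ?case
  proof (cases k)
    case 0
    then have "f = 0" using pCons.prems by (simp split: if_splits)
    then show ?thesis by (simp add: 0 lprod_const_const quadratic_gen_def)
  next
    case (Suc j)
    then have "degree f \<le> j" using pCons.prems by (simp split: if_splits)
    then show ?thesis
      using pCons.IH[of j]
      by (simp add: Suc lprod_pCons_left[of v f] lprod_const_const quadratic_gen_def coeff_pCons)
  qed
qed

text \<open>Here the top term is multiplied by \<open>(\<partial> + \<lambda>)\<^sup>k\<close>; to reach \<open>\<lambda>\<^sup>k\<^sup>+\<^sup>1\<close> each of these factors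
  has to contribute its \<open>\<lambda>\<close>, and the generator formula supplies one more. The summands with \<open>\<partial>\<close>
  disappear in the induction because the coefficients above the degree vanish as well, which is
  why all \<open>k\<close> from the degree on are covered.\<close>

lemma coeff_lprod_const_left:
  "degree f \<le> k \<Longrightarrow> coeff (lprod [:a:] f) (Suc k) = [:a \<rhd> coeff f k + coeff f k \<lhd> a:]"
proof (induction f arbitrary: k)
  case 0
  show ?case by simp
next
  case (pCons v f)
  show ?case
  proof (cases k)
    case 0
    then have "f = 0" using pCons.prems by (simp split: if_splits)
    then show ?thesis by (simp add: 0 lprod_const_const quadratic_gen_def)
  next
    case (Suc j)
    then have j: "degree f \<le> j" using pCons.prems by (simp split: if_splits)
    then have "coeff f (Suc j) = 0" by (simp add: coeff_eq_0)
    with j show ?thesis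
      using pCons.IH[of j] pCons.IH[of "Suc j"]
      by (simp add: Suc lprod_pCons_right[of _ v f] lprod_const_const quadratic_gen_def
          coeff_map_poly coeff_pCons)
  qed
qed

definition constant_part :: "'a poly set \<Rightarrow> 'a set"
  where "constant_part I = {v. [:v:] \<in> I}"

context
  fixes I
  assumes I: "conformal.conformal_ideal I"
begin

lemma
  shows conformal_ideal_subspace: "conformal.subspace I"
    and conformal_ideal_left: "f \<in> I \<Longrightarrow> coeff (lprod f g) n \<in> I"
    and conformal_ideal_right: "f \<in> I \<Longrightarrow> coeff (lprod g f) n \<in> I"
  using I by (auto simp: conformal.conformal_ideal_def)

lemma conformal_ideal_shift: "f \<in> I \<Longrightarrow> pCons 0 f \<in> I"
  using conformal.subspace_scale[OF conformal_ideal_subspace, of f "[:0, 1:]"]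
  by (simp add: free_scale_indeterminate)

lemma conformal_ideal_eq_UNIV:
  assumes "constant_part I = UNIV"
  shows "I = UNIV"
proof -
  have "f \<in> I" for f
  proof (induction f)
    case 0
    show ?case by (rule conformal.subspace_0[OF conformal_ideal_subspace])
  next
    case (pCons a f)
    have "[:a:] \<in> I" using assms by (auto simp: constant_part_def)
    then show ?case
      unfolding pCons_split[of a f]
      by (intro conformal.subspace_add[OF conformal_ideal_subspace] conformal_ideal_shift pCons.IH)
  qed
  then show ?thesis by auto
qed

lemma subspace_constant_part: "subspace (constant_part I)"
proof (rule subspaceI)
  show "0 \<in> constant_part I"
    using conformal.subspace_0[OF conformal_ideal_subspace] by (simp add: constant_part_def)
  show "v + w \<in> constant_part I" if "v \<in> constant_part I" "w \<in> constant_part I" for v w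
    using conformal.subspace_add[OF conformal_ideal_subspace, of "[:v:]" "[:w:]"] that
    by (simp add: constant_part_def)
  show "scale z v \<in> constant_part I" if "v \<in> constant_part I" for z v
    using conformal.subspace_scale[OF conformal_ideal_subspace, of "[:v:]" "[:z:]"] that
    by (simp add: constant_part_def free_scale_const map_poly_pCons)
qed

text \<open>For \<open>f \<in> I\<close> of degree \<open>n\<close> the coefficients of \<open>\<lambda>\<^sup>n\<^sup>+\<^sup>1\<close> in \<open>f\<^sub>\<lambda> a\<close> and \<open>a\<^sub>\<lambda> f\<close> are constants of the ideal, and the
  assumption on \<open>a\<close>, applied to the leading coefficient of \<open>f\<close>, makes one of them non-zero.\<close>

lemma constant_part_nonzero:
  assumes "I \<noteq> {0}" and a: "\<And>b. b \<noteq> 0 \<Longrightarrow> a \<rhd> b + b \<lhd> a \<noteq> 0 \<or> b \<rhd> a + a \<lhd> b \<noteq> 0"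
  shows "constant_part I \<noteq> {0}"
proof -
  from assms(1) obtain f where f: "f \<in> I" "f \<noteq> 0"
    using conformal.subspace_0[OF conformal_ideal_subspace] by auto
  let ?v = "lead_coeff f"
  have "[:a \<rhd> ?v + ?v \<lhd> a:] \<in> I"
    using conformal_ideal_right[OF f(1), of "[:a:]" "Suc (degree f)"]
    by (simp add: coeff_lprod_const_left)
  moreover have "[:?v \<rhd> a + a \<lhd> ?v:] \<in> I"
  proof -
    let ?w = "[:?v \<rhd> a + a \<lhd> ?v:]"
    have "(if even (degree f) then id else uminus) ?w \<in> I"
      using conformal_ideal_left[OF f(1), of "[:a:]" "Suc (degree f)"]
      by (simp only: coeff_lprod_const_right order_refl)
    then have "?w \<in> I \<or> - ?w \<in> I"
      by (simp only: id_apply split: if_splits) auto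
    then show ?thesis
      using conformal.subspace_neg[OF conformal_ideal_subspace, of "- ?w"] by (auto simp only:
      minus_minus)
  qed
  moreover have "?v \<noteq> 0" using f by simp
  ultimately show ?thesis
    using a[of ?v] by (auto simp: constant_part_def)
qed

text \<open>With \<open>\<rhd>\<close> trivial, the \<open>\<lambda>\<close>-coefficient of \<open>v\<^sub>\<lambda> b\<close> is \<open>b \<lhd> v\<close> by itself; hence \<open>\<partial>(b \<lhd> v)\<close>
  also lies in the ideal and can be subtracted from the constant coefficient \<open>\<partial>(b \<lhd> v) + v \<odot>
  b\<close>. For non-trivial \<open>\<rhd>\<close> only the sum \<open>v \<rhd> b + b \<lhd> v\<close> would be visible.\<close>

lemma constant_part_closed:
  assumes rhd: "\<And>a b. a \<rhd> b = 0" and v: "v \<in> constant_part I"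
  shows "v \<lhd> b \<in> constant_part I" "b \<lhd> v \<in> constant_part I"
    "v \<odot> b \<in> constant_part I" "b \<odot> v \<in> constant_part I"
proof -
  have v: "[:v:] \<in> I" using v by (simp add: constant_part_def)
  note left = conformal_ideal_left[OF v, of "[:b:]", unfolded lprod_const_const quadratic_gen_def]
  note right = conformal_ideal_right[OF v, of "[:b:]", unfolded lprod_const_const quadratic_gen_def]
  have lhd: "[:b \<lhd> v:] \<in> I" "[:v \<lhd> b:] \<in> I"
    using left[of 1] right[of 1] by (simp_all add: rhd)
  then show "b \<lhd> v \<in> constant_part I" "v \<lhd> b \<in> constant_part I"
    by (simp_all add: constant_part_def)
  have "[:v \<odot> b, b \<lhd> v:] - pCons 0 [:b \<lhd> v:] \<in> I"
    using left[of 0] lhd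
    by (intro conformal.subspace_diff[OF conformal_ideal_subspace] conformal_ideal_shift) simp_all
  then show "v \<odot> b \<in> constant_part I" by (simp add: constant_part_def)
  have "[:b \<odot> v, v \<lhd> b:] - pCons 0 [:v \<lhd> b:] \<in> I"
    using right[of 0] lhd
    by (intro conformal.subspace_diff[OF conformal_ideal_subspace] conformal_ideal_shift) simp_all
  then show "b \<odot> v \<in> constant_part I" by (simp add: constant_part_def)
qed

end

end

theorem proposition4p6:
  fixes scale :: "complex \<Rightarrow> 'a::ab_group_add \<Rightarrow> 'a"
    and lhd rhd lsa :: "'a \<Rightarrow> 'a \<Rightarrow> 'a"
  assumes simple: "simple_pre_gelfand_dorfman_algebra scale lhd rhd lsa"
    and rhd_trivial: "\<And>a b. rhd a b = 0"
    and ex: "\<exists>a. \<forall>b. b \<noteq> 0 \<longrightarrow> lhd a b \<noteq> 0 \<or> lhd b a \<noteq> 0"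
  shows "simple_left_symmetric_conformal_algebra (free_scale scale)
           (quadratic_lprod lhd rhd lsa)"
proof -
  interpret V: simple_pre_gelfand_dorfman_algebra scale lhd rhd lsa
    by (rule simple)
  obtain a where a: "\<And>b. b \<noteq> 0 \<Longrightarrow> lhd a b \<noteq> 0 \<or> lhd b a \<noteq> 0"
    using ex by blast
  show ?thesis
  proof
    show "\<not> (\<forall>f g. V.lprod f g = 0)"
    proof
      assume "\<forall>f g. V.lprod f g = 0"
      then have "V.gen v w = 0" for v w
        using V.lprod_const_const by metis
      then show False
        using V.nontrivial rhd_trivial by (simp add: quadratic_gen_def)
    qed
    show "\<not> (\<exists>I. V.conformal.proper_conformal_ideal I)"
    proof
      assume "\<exists>I. V.conformal.proper_conformal_ideal I"
      then obtain I where I: "V.conformal.conformal_ideal I" "I \<noteq> {0}" "I \<noteq> UNIV"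
        by (auto simp: V.conformal.proper_conformal_ideal_def)
      have "V.constant_part I \<noteq> {0}"
        by (rule V.constant_part_nonzero[OF I(1,2), of a]) (use a in \<open>auto simp: rhd_trivial\<close>)
      moreover have "V.constant_part I \<noteq> UNIV"
        using V.conformal_ideal_eq_UNIV[OF I(1)] I(3) by auto
      ultimately have "V.proper_ideal (V.constant_part I)"
        using V.subspace_constant_part[OF I(1)] V.constant_part_closed[OF I(1) rhd_trivial]
          V.subspace_0[OF V.subspace_constant_part[OF I(1)]]
        by (simp add: V.proper_ideal_def rhd_trivial)
      then show False
        using V.no_proper_ideal by blast
    qed
  qed
qed

end
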